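(* There is an absolute constant $K$ such that for all $x>0$ and $\rho>0$, $$H(x,\rho)=\frac{e^{-2x\rho}}{2\rho}+\frac1{\pi\rho}\,\Re\left\{e^{-i\pi x}\int_0^\infty\frac{e^{\frac{ix\rho^3t^3}{6}}}{1+t^2}\,dt\right\}+R,\qquad |R|\le K.$$ In particular, writing $\int_0^\infty\frac{e^{i\lambda t^3/6}}{1+t^2}\,dt=C(\lambda)e^{i\pi\psi(\lambda)}$ (with $C(\lambda)\ge0$ the modulus and $\psi(\lambda)\in\mathbb R$), the following hold. (i) When $x\to\infty$, $\rho\to0$ and $x\rho^3\to\lambda$ with $\lambda>0$, $$H(x,\rho)=\frac{C(\lambda)}{\pi\rho}\cos\big(\pi(x-\psi(\lambda))\big)+o(\rho^{-1}).$$ (ii) When $\rho\to0$, $x\rho\to\infty$ and $x\rho^3\to0$, $$H(x,\rho)=\frac1{2\rho}\cos(\pi x)+o(\rho^{-1}).$$ (iii) When $x\to\infty$ and $x\rho\to\lambda$ with $\lambda\ge0$, $$H(x,\rho)=\frac{e^{-2\lambda}+\cos(\pi x)}{2\rho}+o(\rho^{-1}).$$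
   Context: The restricted Good function is defined for $x\in\mathbb R$ and $\rho>0$ by $$H(x,\rho):=\frac1\pi\int_0^\pi\frac{\cos\big(x(\theta+\sin\theta)\big)}{\rho^2+\sin^2\theta}\,d\theta .$$ In (i)-(iii), $(x,\rho)$ ranges over pairs of positive reals, and the $o(\rho^{-1})$ statements mean that $\rho$ times the error tends to $0$ along any family (e.g. sequence) of pairs $(x,\rho)$ satisfying the stated limits. *)

theory Defs
  imports "HOL-Analysis.Analysis"
begin

definition good_H :: "real \<Rightarrow> real \<Rightarrow> real" where
  "good_H x \<rho> =
     1 / pi * integral {0..pi} (\<lambda>\<theta>. cos (x * (\<theta> + sin \<theta>)) / (\<rho>\<^sup>2 + (sin \<theta>)\<^sup>2))"

definition good_J :: "real \<Rightarrow> complex" where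
  "good_J \<mu> =
     integral {0..} (\<lambda>t::real. exp (\<i> * of_real (\<mu> * t ^ 3 / 6)) / of_real (1 + t\<^sup>2))"

definition good_C :: "real \<Rightarrow> real" where
  "good_C \<mu> = cmod (good_J \<mu>)"

text \<open>The phase is determined by the polar form of \<open>good_J \<mu>\<close> only up to even integers
  (and not at all if \<open>good_J \<mu> = 0\<close>), so it is a relation rather than a chosen branch.\<close>

definition good_phase :: "real \<Rightarrow> real \<Rightarrow> bool" where
  "good_phase \<mu> \<psi> \<longleftrightarrow>
     good_J \<mu> = of_real (good_C \<mu>) * exp (\<i> * of_real pi * of_real \<psi>)"

text \<open>A family of pairs of positive reals is given by functions \<open>x\<close>, \<open>\<rho>\<close> on an arbitrary
  index type; limits are taken along a filter \<open>F\<close> on it (\<open>sequentially\<close> for sequences).\<close>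

definition positive_family :: "'a filter \<Rightarrow> ('a \<Rightarrow> real) \<Rightarrow> ('a \<Rightarrow> real) \<Rightarrow> bool" where
  "positive_family F x \<rho> \<longleftrightarrow> (\<forall>\<^sub>F a in F. x a > 0 \<and> \<rho> a > 0)"

text \<open>\<open>H(x, \<rho>) = M + o(1/\<rho>)\<close> along the family.\<close>

definition good_H_asymp ::
  "'a filter \<Rightarrow> ('a \<Rightarrow> real) \<Rightarrow> ('a \<Rightarrow> real) \<Rightarrow> ('a \<Rightarrow> real) \<Rightarrow> bool" where
  "good_H_asymp F x \<rho> M \<longleftrightarrow> ((\<lambda>a. \<rho> a * (good_H (x a) (\<rho> a) - M a)) \<longlongrightarrow> 0) F"

end

(*
  H splits at pi/2. On each half a substitution turns the phase exactly into the phase of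
  the model integral: w = (t + sin t) / 2 near 0, and w^3 = 6 (s - sin s) with s = pi - t near pi.
  Both substitutions satisfy w = t + O(t^3), so replacing w' / (rho^2 + w^2) by
  1 / (rho^2 + sin^2 t) changes the integrand by O(1) uniformly in rho. The remainder bound
  therefore needs no cancellation: absolute values suffice, whatever x is. The first model
  integral is evaluated by Cauchy's formula on a half disc, the second is J.
  The limits follow since J is continuous and J(0) = pi/2.
*)
theory Submission
  imports Defs "HOL-Complex_Analysis.Complex_Analysis" "HOL-Real_Asymp.Real_Asymp"
begin

text \<open>The kernel \<open>1 / (\<rho>\<^sup>2 + (sin \<theta>)\<^sup>2)\<close> concentrates
  where sin vanishes, at theta = 0 and theta = pi. At 0 the phase theta + sin theta has slope 2, so
  its model is linear and gives a decaying exponential. At pi the slope 1 + cos theta vanishes to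
  second order, so the model is cubic; scaling the distance to pi by rho turns x s^3 / 6 into x
  rho^3 t^3 / 6, which is the argument of J.

  The obstacle is uniformity in x: truncating a Taylor expansion of the phase would leave errors
  that grow with x. An exact change of phase moves the whole error into the kernel, from which x is
  absent. Three errors then remain, all bounded independently of x and rho: the change of kernel
  near 0, the same near pi, and the tails beyond the images of pi/2.\<close>

section \<open>Improper integrals with inverse square decay\<close>

lemma integrable_on_inverse_one_plus_square:
  "(\<lambda>t::real. 1 / (1 + t\<^sup>2)) integrable_on {0..}"
proof -
  have "(\<lambda>t::real. 1 / (1 + t\<^sup>2)) integrable_on {0..1}"
    by (intro integrable_continuous_real continuous_intros) (auto simp: add_nonneg_eq_0_iff)
  moreover have "(\<lambda>t::real. 1 / (1 + t\<^sup>2)) integrable_on {1..}"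
  proof (rule measurable_bounded_by_integrable_imp_integrable)
    show "(\<lambda>t::real. 1 / (1 + t\<^sup>2)) \<in> borel_measurable (lebesgue_on {1..})"
      by (intro continuous_imp_measurable_on_sets_lebesgue continuous_intros)
        (auto simp: add_nonneg_eq_0_iff)
    show "(\<lambda>t::real. 1 / t ^ 2) integrable_on {1..}"
      using has_integral_inverse_power_to_inf[of 2 1] by (auto simp: integrable_on_def)
    show "norm (1 / (1 + t\<^sup>2)) \<le> 1 / t\<^sup>2" if "t \<in> {1..}" for t :: real
      using that by (auto simp: field_simps add_nonneg_pos)
  qed auto
  moreover have "negligible ({0..1} \<inter> {1::real..})"
    by (rule negligible_subset[of "{1}"]) auto
  moreover have "{0..1} \<union> {1::real..} = {0..}" by auto
  ultimately show ?thesis by (metis integrable_Un)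
qed

lemma integrable_inverse_square_decay:
  fixes f :: "real \<Rightarrow> 'b::euclidean_space"
  assumes "continuous_on {0..} f" "\<And>t. t \<ge> 0 \<Longrightarrow> norm (f t) \<le> 1 / (1 + t\<^sup>2)" "T \<ge> 0"
  shows "f integrable_on {T..}"
proof -
  have "f absolutely_integrable_on {0..}"
    using assms integrable_on_inverse_one_plus_square
    by (intro measurable_bounded_by_integrable_imp_absolutely_integrable
        [where g = "\<lambda>t. 1 / (1 + t\<^sup>2)"] continuous_imp_measurable_on_sets_lebesgue) auto
  then have "f absolutely_integrable_on {T..}"
    by (rule set_integrable_subset) (use assms in auto)
  then show ?thesis
    by (simp add: absolutely_integrable_on_def)
qed

text \<open>Comparison with 1 / t^2 on [T, \<infinity>). The explicit rate matters: with T of order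
  1 / rho and a prefactor 1 / rho, the tail of a model integral costs O(1).\<close>

lemma integral_tail_inverse_square_decay:
  fixes f :: "real \<Rightarrow> 'b::euclidean_space"
  assumes "continuous_on {0..} f" "\<And>t. t \<ge> 0 \<Longrightarrow> norm (f t) \<le> 1 / (1 + t\<^sup>2)" "T > 0"
  shows "norm (integral {0..} f - integral {0..T} f) \<le> 1 / T"
proof -
  have "f integrable_on {0..T}"
    using assms by (intro integrable_continuous_real continuous_on_subset[OF assms(1)]) auto
  moreover have tail: "f integrable_on {T..}"
    using assms by (intro integrable_inverse_square_decay) auto
  moreover have "negligible ({0..T} \<inter> {T..})"
    by (rule negligible_subset[of "{T}"]) auto
  moreover have "{0..T} \<union> {T..} = {0..}" using \<open>T > 0\<close> by auto
  ultimately have "integral {0..} f = integral {0..T} f + integral {T..} f"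
    by (metis Henstock_Kurzweil_Integration.integral_Un)
  moreover have "norm (integral {T..} f) \<le> integral {T..} (\<lambda>t. 1 / t ^ 2)"
  proof (rule Henstock_Kurzweil_Integration.integral_norm_bound_integral[OF tail])
    show "(\<lambda>t. 1 / t ^ 2) integrable_on {T..}"
      using has_integral_inverse_power_to_inf[of 2 T] \<open>T > 0\<close> by (auto simp: integrable_on_def)
    show "norm (f t) \<le> 1 / t\<^sup>2" if "t \<in> {T..}" for t
    proof -
      have "norm (f t) \<le> 1 / (1 + t\<^sup>2)" using assms that by auto
      also have "\<dots> \<le> 1 / t\<^sup>2" using assms that by (intro divide_left_mono) (auto simp: add_pos_nonneg)
      finally show ?thesis .
    qed
  qed
  moreover have "integral {T..} (\<lambda>t. 1 / t ^ 2) = 1 / T"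
    using has_integral_inverse_power_to_inf[of 2 T] \<open>T > 0\<close> by (simp add: integral_unique)
  ultimately show ?thesis by simp
qed

lemma integral_inverse_square_decay_LIMSEQ:
  fixes f :: "real \<Rightarrow> 'b::euclidean_space"
  assumes "continuous_on {0..} f" "\<And>t. t \<ge> 0 \<Longrightarrow> norm (f t) \<le> 1 / (1 + t\<^sup>2)"
  shows "(\<lambda>n. integral {0..real n} f) \<longlonglongrightarrow> integral {0..} f"
proof (rule LIM_zero_cancel, rule Lim_null_comparison)
  show "\<forall>\<^sub>F n in sequentially. norm (integral {0..real n} f - integral {0..} f) \<le> 1 / real n"
    using eventually_gt_at_top[of 0]
    by eventually_elim
      (use integral_tail_inverse_square_decay[OF assms] in \<open>auto simp: norm_minus_commute\<close>)
qed (rule lim_1_over_n)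

lemma integral_inverse_one_plus_square:
  "integral {0..} (\<lambda>t::real. 1 / (1 + t\<^sup>2)) = pi / 2"
proof (rule LIMSEQ_unique)
  show "(\<lambda>n. integral {0..real n} (\<lambda>t. 1 / (1 + t\<^sup>2))) \<longlonglongrightarrow> integral {0..} (\<lambda>t::real. 1 / (1 + t\<^sup>2))"
    by (intro integral_inverse_square_decay_LIMSEQ continuous_intros) (auto simp: add_nonneg_eq_0_iff)
  have "integral {0..real n} (\<lambda>t. 1 / (1 + t\<^sup>2)) = arctan (real n)" for n
  proof -
    have "((\<lambda>t. 1 / (1 + t\<^sup>2)) has_integral (arctan (real n) - arctan 0)) {0..real n}"
      by (intro fundamental_theorem_of_calculus)
        (auto simp flip: has_real_derivative_iff_has_vector_derivative
          intro!: derivative_eq_intros simp: field_simps)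
    then show ?thesis by (simp add: integral_unique)
  qed
  then show "(\<lambda>n. integral {0..real n} (\<lambda>t. 1 / (1 + t\<^sup>2))) \<longlonglongrightarrow> pi / 2"
    using filterlim_compose[OF tendsto_arctan_at_top filterlim_real_sequentially] by simp
qed

section \<open>Taylor bounds for sine and cosine\<close>

lemma sin_bounds_cubic:
  fixes t :: real
  assumes "t \<ge> 0"
  shows "sin t \<le> t" "t - t ^ 3 / 6 \<le> sin t" "sin t \<le> t - t ^ 3 / 6 + t ^ 5 / 120"
proof -
  have [simp]: "sin_coeff 3 = - 1 / 6" "sin_coeff 4 = 0" "sin_coeff 2 = 0" "sin_coeff (Suc 0) = 1" "sin_coeff 0 = 0"
    by (simp_all add: sin_coeff_def fact_numeral)
  have "(\<Sum>m<3. sin_coeff m * t ^ m) = t" "(\<Sum>m<5. sin_coeff m * t ^ m) = t - t ^ 3 / 6"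
    by (simp_all add: lessThan_nat_numeral lessThan_Suc)
  then show "sin t \<le> t" "t - t ^ 3 / 6 \<le> sin t" "sin t \<le> t - t ^ 3 / 6 + t ^ 5 / 120"
    using Maclaurin_sin_bound[of t 3] Maclaurin_sin_bound[of t 5] assms sin_x_le_x[of t]
    by (auto simp: fact_numeral abs_le_iff)
qed

lemma one_minus_cos_bounds:
  fixes t :: real
  assumes "0 \<le> t" "t \<le> 2"
  shows "1 - cos t \<le> t\<^sup>2 / 2" "t\<^sup>2 / 2 - t ^ 4 / 24 \<le> 1 - cos t"
proof -
  have c: "1 - cos t = 2 * (sin (t / 2))\<^sup>2"
    using cos_double_sin[of "t / 2"] by simp
  have le: "0 \<le> sin (t/2)"
    using assms pi_gt3 by (intro sin_ge_zero) auto
  then have "(sin (t / 2))\<^sup>2 \<le> (t/2)\<^sup>2"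
    using assms sin_bounds_cubic(1)[of "t/2"] by (intro power_mono) auto
  then show "1 - cos t \<le> t\<^sup>2 / 2" using c by (simp add: power_divide)
  \<comment> \<open>A lower bound can be squared only if it is nonnegative. The margin is wide,
    since t^2 <= 24 would do.\<close>
  have "0 \<le> t/2 - (t/2)^3/6"
  proof -
    have "t * t^2 \<le> t * 2^2" using assms by (intro mult_left_mono power_mono) auto
    then show ?thesis using assms by (simp add: power3_eq_cube power2_eq_square)
  qed
  then have "(t/2 - (t/2)^3/6)\<^sup>2 \<le> (sin (t / 2))\<^sup>2"
    using assms sin_bounds_cubic(2)[of "t/2"] by (intro power_mono) auto
  moreover have "(t/2 - (t/2)^3/6)\<^sup>2 = t^2/4 - t^4/48 + t^6/2304"
    by (simp add: power2_eq_square eval_nat_numeral algebra_simps)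
  moreover have "t^6 \<ge> 0" by simp
  ultimately show "t\<^sup>2 / 2 - t ^ 4 / 24 \<le> 1 - cos t"
    using c by linarith
qed


section \<open>The cosine integral by a half disc contour\<close>

text \<open>Subtracting \<open>exp (- a)\<close> makes the singularity at \<open>\<i>\<close> removable, so that no winding
  number has to be computed.\<close>

lemma upper_half_disc_contour_bound:
  fixes a R :: real
  assumes "a \<ge> 0" "R > 1"
  shows "norm (integral {-R..R} (\<lambda>t. (exp (\<i> * of_real (a * t)) - exp (- of_real a)) / (1 + (of_real t)\<^sup>2) :: complex))
    \<le> 2 / (R\<^sup>2 - 1) * R * pi"
proof -
  define f where "f = (\<lambda>z::complex. (exp (\<i> * of_real a * z) - exp (- of_real a)) / (z + \<i>))"
  define h where "h = (\<lambda>z::complex. (exp (\<i> * of_real a * z) - exp (- of_real a)) / (1 + z\<^sup>2))"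
  \<comment> \<open>This half plane is convex and contains the contour together with i, but not -i,
    the only zero of the denominator of \<open>f\<close>. Cauchy's formula for \<open>f\<close> at i
    thus treats \<open>h\<close>, which is \<open>f\<close> divided by z - i.\<close>
  define S where "S = {z::complex. Im z > -1}"
  define L where "L = linepath (- of_real R) (of_real R :: complex)"
  define A where "A = part_circlepath 0 R 0 pi"
  have fh: "f z / (z - \<i>) = h z" for z
  proof -
    have "(z + \<i>) * (z - \<i>) = 1 + z\<^sup>2" by (simp add: algebra_simps power2_eq_square)
    then show ?thesis by (simp add: f_def h_def)
  qed
  have RR: "R\<^sup>2 > 1" using assms by simp
  have A_image: "norm z = R \<and> Im z \<ge> 0" if "z \<in> path_image A" for z
  proof -
    from that obtain u where u: "0 \<le> u" "u \<le> pi" "z = of_real R * exp (\<i> * of_real u)"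
      by (auto simp: A_def path_image_part_circlepath)
    then have "Im z = R * sin u" by (simp add: Im_exp)
    then show ?thesis using u assms sin_ge_zero[of u] by (auto simp: norm_mult)
  qed
  have L_image: "Im z = 0" if "z \<in> path_image L" for z
    using that by (auto simp: L_def in_segment)
  have ends: "pathfinish L = pathstart A" "pathfinish A = pathstart L"
    by (simp_all add: L_def A_def)
  have hol: "f holomorphic_on S"
    unfolding f_def S_def by (intro holomorphic_intros) (auto simp: complex_eq_iff)
  have "open S" "convex S"
    unfolding S_def by (auto simp: open_halfspace_Im_gt convex_halfspace_Im_gt)
  then have "((\<lambda>w. f w / (w - \<i>)) has_contour_integral
      (2*pi * \<i> * winding_number (L +++ A) \<i> * f \<i>)) (L +++ A)"
  proof (intro Cauchy_integral_formula_convex_simple[OF _ hol])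
    show "valid_path (L +++ A)" using ends by (auto simp: L_def A_def)
    show "path_image (L +++ A) \<subseteq> S - {\<i>}"
      using A_image L_image assms ends by (fastforce simp: path_image_join S_def)
    show "pathfinish (L +++ A) = pathstart (L +++ A)"
      using ends by simp
  qed (auto simp: interior_open S_def)
  moreover have "f \<i> = 0"
  proof -
    have "\<i> * complex_of_real a * \<i> = - of_real a"
      by (metis i_squared mult.commute mult.left_commute mult_minus1 power2_eq_square)
    then show ?thesis by (simp add: f_def)
  qed
  ultimately have "(h has_contour_integral 0) (L +++ A)"
    by (simp add: fh)
  moreover have LA: "h contour_integrable_on L" "h contour_integrable_on A"
    using calculation ends has_contour_integral_integrable contour_integrable_join
    by (metis A_def L_def valid_path_linepath valid_path_part_circlepath)+
  moreover have "contour_integral (L +++ A) h = 0"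
    using \<open>(h has_contour_integral 0) (L +++ A)\<close> by (rule contour_integral_unique)
  moreover have "contour_integral (L +++ A) h = contour_integral L h + contour_integral A h"
    using LA ends by (intro contour_integral_join) (auto simp: L_def A_def)
  ultimately have "contour_integral L h + contour_integral A h = 0" by simp
  moreover have "norm (contour_integral A h) \<le> 2 / (R\<^sup>2 - 1) * R * \<bar>pi - 0\<bar>"
    unfolding A_def
  proof (rule contour_integral_bound_part_circlepath)
    fix z assume "z \<in> path_image (part_circlepath 0 R 0 pi)"
    then have z: "norm z = R" "Im z \<ge> 0" using A_image by (auto simp: A_def)
    \<comment> \<open>On the closed upper half plane exp (i a z) has modulus exp (- a Im z) <= 1;
      here the sign of \<open>a\<close> enters.\<close>
    have "norm (exp (\<i> * of_real a * z) - exp (- of_real a)) \<le> 1 + 1"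
      using z assms by (intro order_trans[OF norm_triangle_ineq4] add_mono) auto
    moreover have "norm (1 + z\<^sup>2) \<ge> R\<^sup>2 - 1"
      using norm_triangle_ineq2[of "z\<^sup>2" "-1"] z by (simp add: norm_power add.commute)
    ultimately show "norm (h z) \<le> 2 / (R\<^sup>2 - 1)"
      unfolding h_def norm_divide using RR by (intro frac_le) auto
  qed (use LA assms RR in \<open>auto simp: A_def\<close>)
  moreover have "contour_integral L h = integral {-R..R} (\<lambda>t. h (of_real t))"
    unfolding L_def using assms by (subst contour_integral_linepath_Reals_eq) auto
  ultimately have "norm (integral {-R..R} (\<lambda>t. h (of_real t))) \<le> 2 / (R\<^sup>2 - 1) * R * pi"
    using pi_gt_zero by (metis add_eq_0_iff2 norm_minus_cancel abs_of_pos diff_zero)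
  then show ?thesis by (simp add: h_def mult.assoc)
qed

text \<open>The contour bound tends to 0 as R grows, so the integral of \<open>c\<close> equals exp
  (- a) times that of \<open>d\<close>, which arctan evaluates. Real parts remove the sine, and
  evenness makes the integral over [0, R] half of that over [-R, R], hence half the contour
  bound.\<close>

lemma integral_cos_over_one_plus_square:
  fixes a :: real
  assumes "a \<ge> 0"
  shows "integral {0..} (\<lambda>t. cos (a * t) / (1 + t\<^sup>2)) = pi / 2 * exp (- a)"
proof -
  define c where "c = (\<lambda>t. cos (a * t) / (1 + t\<^sup>2))"
  define d where "d = (\<lambda>t::real. 1 / (1 + t\<^sup>2))"
  have nz: "1 + t\<^sup>2 \<noteq> 0" for t :: real by (simp add: add_nonneg_eq_0_iff)
  have cont: "continuous_on X c" "continuous_on X d" for X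
    unfolding c_def d_def by (auto intro!: continuous_intros simp: nz)
  have bnd: "norm (c t) \<le> 1 / (1 + t\<^sup>2)" "norm (d t) \<le> 1 / (1 + t\<^sup>2)" for t
    unfolding c_def d_def by (auto simp: abs_div intro!: divide_right_mono)
  have lim: "(\<lambda>n. integral {0..real n} c - exp (- a) * integral {0..real n} d)
      \<longlonglongrightarrow> integral {0..} c - exp (- a) * integral {0..} d"
    by (intro tendsto_intros integral_inverse_square_decay_LIMSEQ cont bnd)
  moreover have "(\<lambda>n. integral {0..real n} c - exp (- a) * integral {0..real n} d) \<longlonglongrightarrow> 0"
  proof (rule Lim_null_comparison)
    show "(\<lambda>n. 1 / (real n ^ 2 - 1) * real n * pi) \<longlonglongrightarrow> 0" by real_asymp
    show "\<forall>\<^sub>F n in sequentially. norm (integral {0..real n} c - exp (- a) * integral {0..real n} d)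
       \<le> 1 / (real n ^ 2 - 1) * real n * pi"
      using eventually_gt_at_top[of 1]
    proof eventually_elim
      case (elim n)
      define R where "R = real n"
      define e where "e = (\<lambda>t. c t - exp (- a) * d t)"
      define g :: "real \<Rightarrow> complex"
        where "g = (\<lambda>t. (exp (\<i> * of_real (a * t)) - exp (- of_real a)) / (1 + (of_real t)\<^sup>2))"
      have "R > 1" using elim by (simp add: R_def)
      have cnz: "1 + (of_real t)\<^sup>2 \<noteq> (0::complex)" for t :: real
        using nz[of t] by (metis of_real_1 of_real_add of_real_eq_0_iff of_real_power)
      have int_g: "g integrable_on {-R..R}" unfolding g_def
        by (intro integrable_continuous_real continuous_intros) (auto simp: cnz)
      have Re_g: "Re (g t) = e t" for t
      proof -
        have "g t = (exp (\<i> * of_real (a * t)) - of_real (exp (- a))) / of_real (1 + t\<^sup>2)"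
          by (simp add: g_def exp_of_real flip: of_real_minus)
        then show ?thesis
          by (simp only: Re_divide_of_real)
            (simp add: Re_exp e_def c_def d_def diff_divide_distrib)
      qed
      have int: "c integrable_on {x..y}" "d integrable_on {x..y}" "e integrable_on {x..y}" for x y
        unfolding e_def by (intro integrable_continuous_real continuous_intros cont)+
      have "integral {-R..R} e = Re (integral {-R..R} g)"
        using integral_linear[OF int_g bounded_linear_Re] by (simp add: o_def Re_g)
      then have *: "\<bar>integral {-R..R} e\<bar> \<le> norm (integral {-R..R} g)"
        by (simp only: abs_Re_le_cmod)
      have "integral {-R..R} e = integral {-R..0} e + integral {0..R} e"
        using \<open>R > 1\<close> int by (subst Henstock_Kurzweil_Integration.integral_combine) auto
      moreover have "integral {-R..-0} (\<lambda>t. e (- t)) = integral {0..R} e"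
        by (rule Henstock_Kurzweil_Integration.integral_reflect_real)
      moreover have "(\<lambda>t. e (- t)) = e" by (simp add: e_def c_def d_def)
      ultimately have "integral {-R..R} e = 2 * integral {0..R} e" by simp
      moreover have "integral {0..R} e = integral {0..R} c - exp (- a) * integral {0..R} d"
        unfolding e_def using int
        by (subst Henstock_Kurzweil_Integration.integral_diff) (auto intro: integrable_on_mult_right)
      ultimately show ?case
        using upper_half_disc_contour_bound[OF assms \<open>R > 1\<close>] * by (simp add: g_def R_def)
    qed
  qed
  ultimately have "integral {0..} c = exp (- a) * integral {0..} d"
    using LIMSEQ_unique by fastforce
  then show ?thesis
    using integral_inverse_one_plus_square by (simp add: c_def d_def)
qed

section \<open>Replacing the kernel under a substitution\<close>

text \<open>With P and Q the two denominators, the difference is (Q - P) / (P Q) + (1 - w') / Q.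
  Both sin^2 t and w^2 lie between t^2 - t^4 / 3 and t^2, so |Q - P| <= t^4 / 3, while P and Q are
  at least t^2 / 4 for every rho. The powers of t cancel and leave 16/3 + 4 < 10.\<close>

lemma kernel_difference_bound:
  fixes t w w' \<rho> :: real
  assumes t: "0 < t" "t \<le> pi / 2"
    and w: "t / 2 \<le> w" "w \<le> t" "t\<^sup>2 - t ^ 4 / 3 \<le> w\<^sup>2"
    and w': "\<bar>w' - 1\<bar> \<le> t\<^sup>2"
  shows "\<bar>1 / (\<rho>\<^sup>2 + (sin t)\<^sup>2) - w' / (\<rho>\<^sup>2 + w\<^sup>2)\<bar> \<le> 10"
proof -
  \<comment> \<open>A rational bound for pi / 2, small enough to give t^2 <= 3 and hence sin t >= t
    / 2.\<close>
  have t2: "t \<le> 8 / 5" using t pi_approx by simp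
  then have "t * t^2 \<le> t * (8/5)^2" using t by (intro mult_left_mono power_mono) auto
  then have "t ^ 3 / 6 \<le> t / 2" using t by (simp add: power3_eq_cube power2_eq_square)
  then have s: "t / 2 \<le> sin t" "sin t \<le> t"
    using sin_bounds_cubic[of t] t by linarith+
  have "0 \<le> t - t^3/6" using \<open>t ^ 3 / 6 \<le> t / 2\<close> t by simp
  then have "(t - t^3/6)\<^sup>2 \<le> (sin t)\<^sup>2"
    using sin_bounds_cubic(2)[of t] t by (intro power_mono) auto
  moreover have "(t - t^3/6)\<^sup>2 = t\<^sup>2 - t^4/3 + t^6/36"
    by (simp add: power2_eq_square eval_nat_numeral algebra_simps)
  moreover have "t^6 \<ge> 0" by simp
  ultimately have s2: "t\<^sup>2 - t^4/3 \<le> (sin t)\<^sup>2" by linarith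
  have sq_le: "(sin t)\<^sup>2 \<le> t\<^sup>2" "w\<^sup>2 \<le> t\<^sup>2" "(t/2)\<^sup>2 \<le> (sin t)\<^sup>2" "(t/2)\<^sup>2 \<le> w\<^sup>2"
    using s w t by (auto intro!: power_mono)
  define P where "P = \<rho>\<^sup>2 + (sin t)\<^sup>2"
  define Q where "Q = \<rho>\<^sup>2 + w\<^sup>2"
  have PQ: "P \<ge> t\<^sup>2 / 4" "Q \<ge> t\<^sup>2 / 4"
    unfolding P_def Q_def using sq_le by (auto simp: power_divide intro: add_increasing)
  have t_pos: "t\<^sup>2 / 4 > 0" using t by simp
  have pos: "P > 0" "Q > 0" using PQ t_pos by linarith+
  have "1 / P - w' / Q = (Q - P) / (P * Q) + (1 - w') / Q"
    using pos by (simp add: field_simps)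
  moreover have "\<bar>(Q - P) / (P * Q)\<bar> \<le> (t^4/3) / (t\<^sup>2/4 * (t\<^sup>2/4))"
    unfolding abs_divide
  proof (rule frac_le)
    show "\<bar>Q - P\<bar> \<le> t^4/3" unfolding P_def Q_def using s2 w(3) sq_le(1,2) by linarith
    show "t\<^sup>2/4 * (t\<^sup>2/4) \<le> \<bar>P * Q\<bar>"
    proof -
      have "t\<^sup>2/4 * (t\<^sup>2/4) \<le> P * Q"
        by (rule mult_mono) (use pos PQ t_pos in linarith)+
      then show ?thesis using pos by (simp add: abs_mult)
    qed
  qed (use t in auto)
  moreover have "(t^4/3) / (t\<^sup>2/4 * (t\<^sup>2/4)) = 16/3"
    using t by (simp add: field_simps power2_eq_square eval_nat_numeral)
  moreover have "\<bar>(1 - w') / Q\<bar> \<le> t\<^sup>2 / (t\<^sup>2/4)"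
    unfolding abs_divide using w' PQ t_pos pos by (intro frac_le) (auto simp: abs_minus_commute)
  moreover have "t\<^sup>2 / (t\<^sup>2/4) = 4" using t by simp
  ultimately show ?thesis unfolding P_def[symmetric] Q_def[symmetric] by linarith
qed

text \<open>The common core of both halves, with \<open>E\<close> the oscillating factor as a
  function of the new variable. It multiplies both kernels at the same point \<open>w t\<close>, so
  only |E| <= 1 enters and the frequency hidden in \<open>E\<close> does not affect the bound. The
  constant is 20 for the kernels (10 times a length below 2) plus 2 for the tail.\<close>

lemma integral_change_kernel_bound:
  fixes E w w' :: "real \<Rightarrow> real" and \<rho> :: real
  assumes E: "continuous_on UNIV E" "\<And>v. \<bar>E v\<bar> \<le> 1"
    and w_cont: "continuous_on {0..pi/2} w"
    and deriv: "\<And>t. 0 < t \<Longrightarrow> t \<le> pi/2 \<Longrightarrow> (w has_field_derivative w' t) (at t)"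
    and w: "\<And>t. 0 \<le> t \<Longrightarrow> t \<le> pi/2 \<Longrightarrow> t / 2 \<le> w t \<and> w t \<le> t"
    and w2: "\<And>t. 0 \<le> t \<Longrightarrow> t \<le> pi/2 \<Longrightarrow> t\<^sup>2 - t ^ 4 / 3 \<le> (w t)\<^sup>2"
    and w': "\<And>t. 0 < t \<Longrightarrow> t \<le> pi/2 \<Longrightarrow> \<bar>w' t - 1\<bar> \<le> t\<^sup>2"
    and "\<rho> > 0"
  shows "\<bar>integral {0..pi/2} (\<lambda>t. E (w t) / (\<rho>\<^sup>2 + (sin t)\<^sup>2))
    - 1 / \<rho> * integral {0..} (\<lambda>t. E (\<rho> * t) / (1 + t\<^sup>2))\<bar> \<le> 22"
proof -
  define f where "f = (\<lambda>t. E (\<rho> * t) / (1 + t\<^sup>2))"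
  define T where "T = w (pi/2) / \<rho>"
  define A where "A = (\<lambda>t. E (w t) / (\<rho>\<^sup>2 + (sin t)\<^sup>2))"
  define B where "B = (\<lambda>t. w' t * E (w t) / (\<rho>\<^sup>2 + (w t)\<^sup>2))"
  have nz: "1 + t\<^sup>2 \<noteq> 0" for t :: real by (simp add: add_nonneg_eq_0_iff)
  have f_cont: "continuous_on X f" for X
    unfolding f_def
    by (intro continuous_intros continuous_on_compose2[OF E(1)]) (auto simp: nz)
  have f_bound: "norm (f t) \<le> 1 / (1 + t\<^sup>2)" for t
    unfolding f_def using E by (auto simp: abs_div intro!: divide_right_mono)
  have wpi: "pi/4 \<le> w (pi/2)" using w[of "pi/2"] by simp
  have w0: "w 0 = 0" using w[of 0] by simp
  have T: "T > 0" unfolding T_def using wpi \<open>\<rho> > 0\<close> pi_gt_zero by (intro divide_pos_pos) linarith+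
  have "((\<lambda>t. (w' t / \<rho>) *\<^sub>R f (w t / \<rho>)) has_integral
      (integral {w 0 / \<rho>..w (pi/2) / \<rho>} f - integral {w (pi/2) / \<rho>..w 0 / \<rho>} f)) {0..pi/2}"
  \<comment> \<open>The point 0 is exempt from differentiability: for the cube root substitution the
    formula for \<open>w'\<close> reads 0/0 there.\<close>
  proof (rule has_integral_substitution_general[where s = "{0}" and c = 0 and d = "pi/2/\<rho>"])
    show "(\<lambda>t. w t / \<rho>) ` {0..pi/2} \<subseteq> {0..pi/2/\<rho>}"
    proof safe
      fix t assume "t \<in> {0..pi/2}"
      then have "0 \<le> w t" "w t \<le> pi/2" using w[of t] by auto
      then show "w t / \<rho> \<in> {0..pi/2/\<rho>}"
        using \<open>\<rho> > 0\<close> divide_right_mono[of "w t" "pi/2" \<rho>] by simp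
    qed
    show "((\<lambda>t. w t / \<rho>) has_real_derivative w' t / \<rho>) (at t within {0..pi/2})"
      if "t \<in> {0..pi/2} - {0}" for t
      using deriv[of t] that by (auto intro: DERIV_cdivide[OF has_field_derivative_at_within])
    show "continuous_on {0..pi/2} (\<lambda>t. w t / \<rho>)"
      using w_cont \<open>\<rho> > 0\<close> by (intro continuous_intros) auto
  qed (rule finite.intros f_cont | simp)+
  moreover have "{w (pi/2) / \<rho>..w 0 / \<rho>} = {}" using T by (simp add: w0 T_def)
  ultimately have "((\<lambda>t. (w' t / \<rho>) *\<^sub>R f (w t / \<rho>)) has_integral integral {0..T} f) {0..pi/2}"
    by (simp add: w0 T_def)
  then have "((\<lambda>t. 1 / \<rho> * ((w' t / \<rho>) *\<^sub>R f (w t / \<rho>))) has_integral 1 / \<rho> * integral {0..T} f) {0..pi/2}"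
    by (rule has_integral_mult_right)
  moreover have "1 / \<rho> * ((w' t / \<rho>) *\<^sub>R f (w t / \<rho>)) = B t" for t
  proof -
    have "\<rho>\<^sup>2 + (w t)\<^sup>2 = \<rho>\<^sup>2 * (1 + (w t / \<rho>)\<^sup>2)"
      using \<open>\<rho> > 0\<close> by (simp add: power_divide distrib_left)
    then have "B t = w' t * E (w t) / (\<rho>\<^sup>2 * (1 + (w t / \<rho>)\<^sup>2))"
      by (simp only: B_def)
    then show ?thesis using \<open>\<rho> > 0\<close>
      by (simp only: f_def nonzero_mult_div_cancel_left) (simp add: power2_eq_square mult.assoc)
  qed
  ultimately have B: "(B has_integral 1 / \<rho> * integral {0..T} f) {0..pi/2}" by simp
  have A: "A integrable_on {0..pi/2}"
    unfolding A_def
    by (intro integrable_continuous_real continuous_intros continuous_on_compose2[OF E(1)] w_cont)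
      (use \<open>\<rho> > 0\<close> in \<open>auto simp: add_nonneg_eq_0_iff\<close>)
  have "\<bar>integral {0..pi/2} A - 1 / \<rho> * integral {0..T} f\<bar> \<le> 20"
  proof -
    have "((\<lambda>t. A t - B t) has_integral (integral {0..pi/2} A - 1 / \<rho> * integral {0..T} f)) {0..pi/2}"
      by (intro has_integral_diff integrable_integral A B)
    then have "norm (integral {0..pi/2} A - 1 / \<rho> * integral {0..T} f) \<le> 10 * measure lborel (cbox 0 (pi/2))"
      unfolding box_real[symmetric]
    proof (rule has_integral_bound_spike_finite[rotated 2])
      fix t assume t: "t \<in> cbox 0 (pi/2) - {0}"
      have "A t - B t = E (w t) * (1 / (\<rho>\<^sup>2 + (sin t)\<^sup>2) - w' t / (\<rho>\<^sup>2 + (w t)\<^sup>2))"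
        by (simp add: A_def B_def right_diff_distrib mult.commute)
      moreover have "\<bar>1 / (\<rho>\<^sup>2 + (sin t)\<^sup>2) - w' t / (\<rho>\<^sup>2 + (w t)\<^sup>2)\<bar> \<le> 10"
        using t w[of t] w2[of t] w'[of t] by (intro kernel_difference_bound) auto
      ultimately have "norm (A t - B t) \<le> 1 * 10"
        unfolding real_norm_def by (simp only: abs_mult) (intro mult_mono E(2), auto)
      then show "norm (A t - B t) \<le> 10" by simp
    qed auto
    also have "\<dots> \<le> 20" using pi_less_4 by simp
    finally show ?thesis by simp
  qed
  \<comment> \<open>Moving the cutoff from \<open>T\<close> to infinity costs at most 1 / (rho T) =
    1 / w(pi/2) <= 4 / pi, in which rho has cancelled.\<close>
  moreover have "\<bar>1 / \<rho> * integral {0..} f - 1 / \<rho> * integral {0..T} f\<bar> \<le> 2"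
  proof -
    have "\<bar>1 / \<rho> * integral {0..} f - 1 / \<rho> * integral {0..T} f\<bar>
        = 1 / \<rho> * norm (integral {0..} f - integral {0..T} f)"
      using \<open>\<rho> > 0\<close> by (simp add: abs_mult flip: right_diff_distrib diff_divide_distrib)
    also have "\<dots> \<le> 1 / \<rho> * (1 / T)"
      using \<open>\<rho> > 0\<close> by (intro mult_left_mono integral_tail_inverse_square_decay f_cont f_bound T) auto
    also have "\<dots> = 1 / w (pi/2)" using \<open>\<rho> > 0\<close> by (simp add: T_def)
    also have "\<dots> \<le> 1 / (pi/4)" using wpi pi_gt_zero by (intro frac_le) auto
    also have "\<dots> \<le> 2" using pi_gt3 by (simp add: field_simps)
    finally show ?thesis .
  qed
  ultimately have "\<bar>integral {0..pi/2} A - 1 / \<rho> * integral {0..} f\<bar> \<le> 22" by linarith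
  then show ?thesis by (simp add: A_def f_def)
qed

section \<open>The substitutions near 0 and near pi\<close>

lemma le_half_pi_power2:
  fixes t :: real
  assumes "0 \<le> t" "t \<le> pi / 2"
  shows "t\<^sup>2 \<le> 5 / 2"
proof -
  have "t \<le> 1.575" using assms pi_approx by simp
  then have "t\<^sup>2 \<le> 1.575\<^sup>2" using assms by (intro power_mono) auto
  then show ?thesis by (simp add: power2_eq_square)
qed

text \<open>Halving t + sin t normalises the substitution to slope 1 at 0. The frequency becomes 2 x
  in return, so the model integral has parameter a = 2 x rho, the exponent in the main term.\<close>

lemma good_integral_near_zero:
  fixes x \<rho> :: real
  assumes "x > 0" "\<rho> > 0"
  shows "\<bar>integral {0..pi/2} (\<lambda>t. cos (x * (t + sin t)) / (\<rho>\<^sup>2 + (sin t)\<^sup>2))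
    - pi / (2 * \<rho>) * exp (- 2 * x * \<rho>)\<bar> \<le> 22"
proof -
  have "\<bar>integral {0..pi/2} (\<lambda>t. cos (2 * x * ((t + sin t) / 2)) / (\<rho>\<^sup>2 + (sin t)\<^sup>2))
    - 1 / \<rho> * integral {0..} (\<lambda>t. cos (2 * x * (\<rho> * t)) / (1 + t\<^sup>2))\<bar> \<le> 22"
  proof (rule integral_change_kernel_bound
      [where E = "\<lambda>v. cos (2 * x * v)" and w = "\<lambda>t. (t + sin t) / 2" and w' = "\<lambda>t. (1 + cos t) / 2"])
    fix t :: real assume t: "0 \<le> t" "t \<le> pi/2"
    have t2: "t\<^sup>2 \<le> 5/2" by (rule le_half_pi_power2[OF t])
    have s: "0 \<le> sin t" using t by (intro sin_ge_zero) auto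
    then show "t / 2 \<le> (t + sin t) / 2 \<and> (t + sin t) / 2 \<le> t"
      using sin_bounds_cubic(1)[of t] t by simp
    have "t * t\<^sup>2 \<le> t * (5/2)" using t t2 by (intro mult_left_mono) auto
    then have "0 \<le> t - t^3/12" using t by (simp add: power3_eq_cube power2_eq_square)
    then have "(t - t^3/12)\<^sup>2 \<le> ((t + sin t) / 2)\<^sup>2"
      using sin_bounds_cubic(2)[of t] t by (intro power_mono) auto
    moreover have "(t - t^3/12)\<^sup>2 = t\<^sup>2 - t^4/6 + t^6/144"
      by (simp add: power2_eq_square eval_nat_numeral algebra_simps)
    moreover have "t^6 \<ge> 0" "t^4 \<ge> 0" by simp_all
    ultimately show "t\<^sup>2 - t^4/3 \<le> ((t + sin t) / 2)\<^sup>2" by linarith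
  next
    fix t :: real assume t: "0 < t" "t \<le> pi/2"
    have c: "1 - cos t \<le> t\<^sup>2 / 2" using t pi_less_4 by (intro one_minus_cos_bounds) auto
    have "\<bar>(1 + cos t) / 2 - 1\<bar> = (1 - cos t) / 2"
    proof -
      have "(1 + cos t) / 2 - 1 \<le> 0" by simp
      then show ?thesis by (simp only: abs_of_nonpos) (simp add: field_simps)
    qed
    also have "\<dots> \<le> t\<^sup>2" using c zero_le_power2[of t] by argo
    finally show "\<bar>(1 + cos t) / 2 - 1\<bar> \<le> t\<^sup>2" .
    show "((\<lambda>t. (t + sin t) / 2) has_real_derivative (1 + cos t) / 2) (at t)"
      by (auto intro!: derivative_eq_intros)
  qed (use assms in \<open>auto intro!: continuous_intros\<close>)
  moreover have "integral {0..} (\<lambda>t. cos (2 * x * (\<rho> * t)) / (1 + t\<^sup>2)) = pi / 2 * exp (- 2 * x * \<rho>)"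
    using integral_cos_over_one_plus_square[of "2 * x * \<rho>"] assms by (simp add: mult.assoc)
  moreover have "1 / \<rho> * (pi / 2 * exp (- 2 * x * \<rho>)) = pi / (2 * \<rho>) * exp (- 2 * x * \<rho>)"
    by simp
  moreover have "2 * x * ((t + sin t) / 2) = x * (t + sin t)" for t by simp
  ultimately show ?thesis by (simp only:)
qed

text \<open>The lower bounds come from \<open>t (1 - t\<^sup>2 / 20) \<le> w\<close>, which holds since
  \<open>w\<^sup>3 \<ge> t\<^sup>3 (1 - t\<^sup>2 / 20)\<close> and \<open>c\<^sup>3 \<le> c\<close> for \<open>0 \<le> c \<le> 1\<close>.\<close>

lemma root_kepler_bounds:
  fixes t :: real
  assumes t: "0 \<le> t" "t \<le> pi / 2"
  defines "w \<equiv> root 3 (6 * (t - sin t))"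
  shows "t / 2 \<le> w" "w \<le> t" "t\<^sup>2 - t ^ 4 / 10 \<le> w\<^sup>2"
proof -
  have t2: "t\<^sup>2 \<le> 5/2" by (rule le_half_pi_power2[OF t])
  \<comment> \<open>Six times the quintic Taylor bound for t - sin t is t^3 - t^5 / 20 = t^3
    c.\<close>
  define c where "c = 1 - t\<^sup>2 / 20"
  have c: "1/2 \<le> c" "c \<le> 1" using t2 by (auto simp: c_def)
  have w3: "w ^ 3 = 6 * (t - sin t)" by (simp add: w_def odd_real_root_pow)
  have w_nonneg: "w \<ge> 0" using sin_bounds_cubic(1)[of t] t by (simp add: w_def)
  have "w ^ 3 \<le> t ^ 3" using w3 sin_bounds_cubic(2)[of t] t by simp
  then show "w \<le> t" using t by (simp add: power_mono_iff w_nonneg)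
  have "(t * c) ^ 3 = t ^ 3 * (c * c\<^sup>2)" by (simp add: power_mult_distrib power3_eq_cube power2_eq_square)
  also have "\<dots> \<le> t ^ 3 * (c * 1)"
    using t c by (intro mult_left_mono) (auto simp: power_le_one)
  also have "\<dots> = t ^ 3 - t ^ 5 / 20"
    by (simp add: c_def eval_nat_numeral algebra_simps)
  also have "\<dots> \<le> w ^ 3" using w3 sin_bounds_cubic(3)[of t] t by simp
  finally have tc: "t * c \<le> w" using w_nonneg t c by (simp add: power_mono_iff)
  have "t * (1/2) \<le> t * c" using t c by (intro mult_left_mono) auto
  then show "t / 2 \<le> w" using tc by simp
  have "(t * c)\<^sup>2 \<le> w\<^sup>2" using tc t c by (intro power_mono) auto
  moreover have "(t * c)\<^sup>2 = t\<^sup>2 - t^4/10 + t^6/400"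
    by (simp add: c_def power2_eq_square eval_nat_numeral algebra_simps)
  moreover have "t^6 \<ge> 0" by simp
  ultimately show "t\<^sup>2 - t ^ 4 / 10 \<le> w\<^sup>2" by linarith
qed

text \<open>Here t is the distance to pi. Since t - sin t starts with t^3 / 6, the factor 6 under
  the cube root makes w tangent to t at 0, and the phase becomes an exact cubic in w.\<close>

lemma good_integral_near_pi:
  fixes x \<rho> :: real
  assumes "x > 0" "\<rho> > 0"
  shows "\<bar>integral {0..pi/2} (\<lambda>t. cos (x * (pi - (t - sin t))) / (\<rho>\<^sup>2 + (sin t)\<^sup>2))
    - 1 / \<rho> * integral {0..} (\<lambda>t. cos (x * (pi - (\<rho> * t) ^ 3 / 6)) / (1 + t\<^sup>2))\<bar> \<le> 22"
proof -
  define w where "w = (\<lambda>t::real. root 3 (6 * (t - sin t)))"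
  \<comment> \<open>Obtained by differentiating w^3 = 6 (t - sin t); it is the derivative of
    \<open>w\<close> only for t > 0.\<close>
  define w' where "w' = (\<lambda>t. 2 * (1 - cos t) / (w t)\<^sup>2)"
  have "\<bar>integral {0..pi/2} (\<lambda>t. cos (x * (pi - w t ^ 3 / 6)) / (\<rho>\<^sup>2 + (sin t)\<^sup>2))
    - 1 / \<rho> * integral {0..} (\<lambda>t. cos (x * (pi - (\<rho> * t) ^ 3 / 6)) / (1 + t\<^sup>2))\<bar> \<le> 22"
  proof (rule integral_change_kernel_bound
      [where E = "\<lambda>v. cos (x * (pi - v ^ 3 / 6))" and w = w and w' = w'])
    fix t :: real assume t: "0 \<le> t" "t \<le> pi/2"
    show "t / 2 \<le> w t \<and> w t \<le> t" using root_kepler_bounds[OF t] by (simp add: w_def)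
    have "t^4 \<ge> 0" by simp
    then show "t\<^sup>2 - t^4/3 \<le> (w t)\<^sup>2"
      using root_kepler_bounds(3)[OF t] unfolding w_def by linarith
  next
    fix t :: real assume t: "0 < t" "t \<le> pi/2"
    then have t': "0 \<le> t" "t \<le> 2" using pi_less_4 by auto
    have t2: "t\<^sup>2 \<le> 5/2" using t by (intro le_half_pi_power2) auto
    have w: "t / 2 \<le> w t" "w t \<le> t" "t\<^sup>2 - t ^ 4 / 10 \<le> (w t)\<^sup>2"
      using root_kepler_bounds[of t] t by (auto simp: w_def)
    then have w_pos: "w t > 0" using t by linarith
    have w_le: "(w t)\<^sup>2 \<le> t\<^sup>2" using w w_pos by (intro power_mono) auto
    note cos_bounds = one_minus_cos_bounds[OF t']
    have t4: "t^4 = t\<^sup>2 * t\<^sup>2" by (simp add: eval_nat_numeral)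
    \<comment> \<open>After multiplication by w^2, the claim |w' - 1| <= t^2 says that 2 (1 - cos t)
      lies between (1 - t^2) w^2 and (1 + t^2) w^2. For the upper half, (1 + t^2)(t^2 - t^4/10)
      exceeds t^2 by exactly this nonnegative term.\<close>
    have "0 \<le> t\<^sup>2 * (t\<^sup>2 * (9/10 - t\<^sup>2 / 10))"
      using t2 by (intro mult_nonneg_nonneg) auto
    moreover have "(1 + t\<^sup>2) * (t\<^sup>2 - t^4/10) \<le> (1 + t\<^sup>2) * (w t)\<^sup>2"
      using w by (intro mult_left_mono) auto
    moreover have up: "2 * (1 - cos t) \<le> (1 + t\<^sup>2) * (w t)\<^sup>2"
    proof -
      have "(1 + t\<^sup>2) * (t\<^sup>2 - t^4/10) = t\<^sup>2 + t\<^sup>2 * (t\<^sup>2 * (9/10 - t\<^sup>2 / 10))"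
        unfolding t4 by (simp add: field_simps)
      then have "t\<^sup>2 \<le> (1 + t\<^sup>2) * (w t)\<^sup>2" using calculation by linarith
      moreover have "2 * (1 - cos t) \<le> t\<^sup>2" using cos_bounds(1) by simp
      ultimately show ?thesis by (rule order_trans[rotated])
    qed
    have low: "(1 - t\<^sup>2) * (w t)\<^sup>2 \<le> 2 * (1 - cos t)"
    proof (cases "t\<^sup>2 \<le> 1")
      case True
      then have "(1 - t\<^sup>2) * (w t)\<^sup>2 \<le> (1 - t\<^sup>2) * t\<^sup>2" using w_le by (intro mult_left_mono) auto
      also have "\<dots> = t\<^sup>2 - t^4" unfolding t4 by (simp add: left_diff_distrib)
      also have "\<dots> \<le> 2 * (1 - cos t)"
      proof -
        have "t^4 \<ge> 0" by simp
        then show ?thesis using cos_bounds(2) by argo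
      qed
      finally show ?thesis .
    next
      case False
      then have "(1 - t\<^sup>2) * (w t)\<^sup>2 \<le> 0" by (intro mult_nonpos_nonneg) auto
      also have "0 \<le> 2 * (1 - cos t)" by simp
      finally show ?thesis .
    qed
    have "w' t \<le> 1 + t\<^sup>2" "1 - t\<^sup>2 \<le> w' t"
      unfolding w'_def using up low w_pos by (simp_all add: pos_divide_le_eq pos_le_divide_eq)
    then show "\<bar>w' t - 1\<bar> \<le> t\<^sup>2" by linarith
    have pos: "6 * (t - sin t) > 0" using w_pos by (simp add: w_def)
    have "((\<lambda>t. 6 * (t - sin t)) has_real_derivative 6 * (1 - cos t)) (at t)"
      by (auto intro!: derivative_eq_intros)
    from DERIV_chain2[OF DERIV_real_root[OF _ pos, of 3] this]
    have "(w has_real_derivative inverse (3 * (w t)\<^sup>2) * (6 * (1 - cos t))) (at t)"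
      by (simp add: w_def)
    moreover have "inverse (3 * (w t)\<^sup>2) * (6 * (1 - cos t)) = w' t"
      using w_pos by (simp add: w'_def field_simps)
    ultimately show "(w has_real_derivative w' t) (at t)" by simp
  next
    show "continuous_on {0..pi/2} w" unfolding w_def by (intro continuous_intros)
  qed (use assms in \<open>auto intro!: continuous_intros\<close>)
  moreover have "w t ^ 3 / 6 = t - sin t" for t by (simp add: w_def odd_real_root_pow)
  ultimately show ?thesis by simp
qed

section \<open>Splitting H, and the oscillatory integral J\<close>

text \<open>The reflection theta = pi - t of the second half preserves sin, hence the kernel, and
  turns the phase into pi - (t - sin t).\<close>

lemma good_H_split:
  assumes "\<rho> > 0"
  shows "pi * good_H x \<rho> = integral {0..pi/2} (\<lambda>t. cos (x * (t + sin t)) / (\<rho>\<^sup>2 + (sin t)\<^sup>2))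
    + integral {0..pi/2} (\<lambda>t. cos (x * (pi - (t - sin t))) / (\<rho>\<^sup>2 + (sin t)\<^sup>2))"
proof -
  define f where "f = (\<lambda>t. cos (x * (t + sin t)) / (\<rho>\<^sup>2 + (sin t)\<^sup>2))"
  have cont: "continuous_on X f" for X
    unfolding f_def using assms by (auto intro!: continuous_intros simp: add_nonneg_eq_0_iff)
  have "((\<lambda>t. (- 1) *\<^sub>R f (pi - t)) has_integral
      (integral {pi - 0..pi - pi/2} f - integral {pi - pi/2..pi - 0} f)) {0..pi/2}"
    by (rule has_integral_substitution_general[where s = "{}" and c = 0 and d = pi])
      (auto intro!: derivative_eq_intros continuous_intros cont)
  then have "((\<lambda>t. - f (pi - t)) has_integral - integral {pi/2..pi} f) {0..pi/2}" by simp
  from has_integral_neg[OF this] have "integral {0..pi/2} (\<lambda>t. f (pi - t)) = integral {pi/2..pi} f"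
    by (simp add: integral_unique)
  moreover have "integral {0..pi} f = integral {0..pi/2} f + integral {pi/2..pi} f"
    by (rule Henstock_Kurzweil_Integration.integral_combine[symmetric])
      (auto intro: integrable_continuous_real cont)
  moreover have "(\<lambda>t. f (pi - t)) = (\<lambda>t. cos (x * (pi - (t - sin t))) / (\<rho>\<^sup>2 + (sin t)\<^sup>2))"
    by (auto simp: f_def algebra_simps)
  ultimately show ?thesis by (simp add: good_H_def f_def)
qed

lemma continuous_on_good_J_integrand:
  "continuous_on X (\<lambda>t::real. exp (\<i> * of_real (\<mu> * t ^ 3 / 6)) / of_real (1 + t\<^sup>2))"
  by (intro continuous_intros) (auto simp del: of_real_add simp: add_nonneg_eq_0_iff)

lemma norm_good_J_integrand:
  "norm (exp (\<i> * of_real (\<mu> * t ^ 3 / 6)) / of_real (1 + t\<^sup>2)) = 1 / (1 + t\<^sup>2)" for t :: real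
  by (simp add: norm_divide norm_exp_i_times del: of_real_add of_real_mult of_real_divide)

lemma good_J_integrable:
  "(\<lambda>t::real. exp (\<i> * of_real (\<mu> * t ^ 3 / 6)) / of_real (1 + t\<^sup>2)) integrable_on {0..}"
  by (intro integrable_inverse_square_decay continuous_on_good_J_integrand)
    (simp_all only: norm_good_J_integrand order_refl)

text \<open>With \<open>\<mu>\<close> = x rho^3 the right side is the model integral near pi, so
  this is where J enters.\<close>

lemma Re_rotate_good_J:
  "Re (exp (- \<i> * of_real pi * of_real x) * good_J \<mu>)
    = integral {0..} (\<lambda>t. cos (pi * x - \<mu> * t ^ 3 / 6) / (1 + t\<^sup>2))"
proof -
  let ?e = "exp (- \<i> * of_real pi * of_real x)"
  have "bounded_linear (\<lambda>z. Re (?e * z))"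
    by (intro bounded_linear_compose[OF bounded_linear_Re] bounded_linear_mult_right)
  from integral_linear[OF good_J_integrable[of \<mu>] this]
  have "Re (?e * good_J \<mu>) = integral {0..}
      (\<lambda>t. Re (?e * (exp (\<i> * of_real (\<mu> * t ^ 3 / 6)) / of_real (1 + t\<^sup>2))))"
    by (simp only: good_J_def o_def)
  also have "(\<lambda>t. Re (?e * (exp (\<i> * of_real (\<mu> * t ^ 3 / 6)) / of_real (1 + t\<^sup>2))))
      = (\<lambda>t. cos (pi * x - \<mu> * t ^ 3 / 6) / (1 + t\<^sup>2))"
  proof
    fix t :: real
    have "?e * exp (\<i> * of_real (\<mu> * t ^ 3 / 6)) = cis (- (pi * x - \<mu> * t ^ 3 / 6))"
      unfolding cis_conv_exp exp_add[symmetric] by (simp add: algebra_simps)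
    then have "Re (?e * (exp (\<i> * of_real (\<mu> * t ^ 3 / 6)) / of_real (1 + t\<^sup>2)))
        = Re (cis (- (pi * x - \<mu> * t ^ 3 / 6)) / of_real (1 + t\<^sup>2))"
      by (simp only: times_divide_eq_right)
    also have "\<dots> = cos (pi * x - \<mu> * t ^ 3 / 6) / (1 + t\<^sup>2)"
      unfolding Re_divide_of_real by (simp only: cis.sel cos_minus)
    finally show "Re (?e * (exp (\<i> * of_real (\<mu> * t ^ 3 / 6)) / of_real (1 + t\<^sup>2)))
      = cos (pi * x - \<mu> * t ^ 3 / 6) / (1 + t\<^sup>2)" .
  qed
  finally show ?thesis .
qed

lemma good_J_0: "good_J 0 = of_real (pi / 2)"
proof -
  have "((\<lambda>t::real. 1 / (1 + t\<^sup>2)) has_integral pi / 2) {0..}"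
    using integrable_integral[OF integrable_on_inverse_one_plus_square]
    by (simp add: integral_inverse_one_plus_square)
  then have "((\<lambda>t::real. of_real (1 / (1 + t\<^sup>2)) :: complex) has_integral of_real (pi / 2)) {0..}"
    by (rule has_integral_of_real)
  then show ?thesis by (simp add: good_J_def integral_unique)
qed

text \<open>Dominated convergence: the integrand has modulus 1 / (1 + t^2) whatever the
  parameter.\<close>

lemma isCont_good_J: "isCont good_J \<mu>"
  unfolding continuous_at_sequentially o_def
proof safe
  fix m assume m: "m \<longlonglongrightarrow> \<mu>"
  show "(\<lambda>n. good_J (m n)) \<longlonglongrightarrow> good_J \<mu>"
    unfolding good_J_def
  proof (rule Equivalence_Lebesgue_Henstock_Integration.dominated_convergence(2))
    fix t :: real
    show "(\<lambda>n. exp (\<i> * of_real (m n * t ^ 3 / 6)) / of_real (1 + t\<^sup>2))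
        \<longlonglongrightarrow> exp (\<i> * of_real (\<mu> * t ^ 3 / 6)) / (of_real (1 + t\<^sup>2) :: complex)"
      by (intro tendsto_intros m) (auto simp del: of_real_add simp: add_nonneg_eq_0_iff)
  qed (rule good_J_integrable integrable_on_inverse_one_plus_square
      norm_good_J_integrand[THEN eq_refl])+
qed

section \<open>The uniform remainder and the limit regimes\<close>

text \<open>Each half contributes 22 to the error of pi H; dividing by pi > 1 can only reduce the
  sum 44.\<close>

lemma good_H_main_bound:
  assumes "x > 0" "\<rho> > 0"
  shows "\<bar>good_H x \<rho> - (exp (- 2 * x * \<rho>) / (2 * \<rho>)
     + 1 / (pi * \<rho>) * Re (exp (- \<i> * of_real pi * of_real x) * good_J (x * \<rho> ^ 3)))\<bar> \<le> 44"
    (is "\<bar>?D\<bar> \<le> _")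
proof -
  have "(\<lambda>t. cos (x * (pi - (\<rho> * t) ^ 3 / 6)) / (1 + t\<^sup>2))
      = (\<lambda>t. cos (pi * x - x * \<rho> ^ 3 * t ^ 3 / 6) / (1 + t\<^sup>2))"
    by (simp add: algebra_simps)
  then have J: "Re (exp (- \<i> * of_real pi * of_real x) * good_J (x * \<rho> ^ 3))
      = integral {0..} (\<lambda>t. cos (x * (pi - (\<rho> * t) ^ 3 / 6)) / (1 + t\<^sup>2))"
    by (simp only: Re_rotate_good_J)
  have "pi * ?D = pi * good_H x \<rho> - pi / (2 * \<rho>) * exp (- 2 * x * \<rho>)
      - 1 / \<rho> * integral {0..} (\<lambda>t. cos (x * (pi - (\<rho> * t) ^ 3 / 6)) / (1 + t\<^sup>2))"
    unfolding J using assms by (simp add: field_simps)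
  then have "\<bar>pi * ?D\<bar> \<le> 44"
    unfolding good_H_split[OF assms(2)]
    using good_integral_near_zero[OF assms] good_integral_near_pi[OF assms] by linarith
  then have "pi * \<bar>?D\<bar> \<le> 44" by (simp only: abs_mult abs_of_pos[OF pi_gt_zero])
  moreover have "1 * \<bar>?D\<bar> \<le> pi * \<bar>?D\<bar>" using pi_gt3 by (intro mult_right_mono) auto
  ultimately show ?thesis by (simp only: mult_1 order_trans)
qed

lemma norm_rotation: "norm (exp (- \<i> * of_real pi * of_real x)) = 1"
  by (simp add: norm_exp_eq_Re)

text \<open>The three regimes differ only in the limits \<open>\<mu>\<close> of x rho^3 and
  \<open>e\<close> of exp (- 2 x rho). The rotation exp (- i pi x) need not converge, so it stays
  inside \<open>M\<close>; having modulus 1, it does not enlarge the error of replacing J by its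
  limit.\<close>

lemma good_H_asympI:
  fixes F :: "'a filter"
  assumes pos: "positive_family F x \<rho>" and \<rho>: "(\<rho> \<longlongrightarrow> 0) F"
    and \<mu>: "((\<lambda>a. x a * \<rho> a ^ 3) \<longlongrightarrow> \<mu>) F"
    and e: "((\<lambda>a. exp (- 2 * x a * \<rho> a)) \<longlongrightarrow> e) F"
    and M: "\<And>a. \<rho> a > 0 \<Longrightarrow> \<rho> a * M a
      = e / 2 + Re (exp (- \<i> * of_real pi * of_real (x a)) * good_J \<mu>) / pi"
  shows "good_H_asymp F x \<rho> M"
  unfolding good_H_asymp_def
proof (rule Lim_null_comparison)
  define J where "J = (\<lambda>a. good_J (x a * \<rho> a ^ 3))"
  \<comment> \<open>One term each for the bounded remainder scaled by rho, the exponential, and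
    J.\<close>
  define B where "B = (\<lambda>a. \<bar>\<rho> a\<bar> * 44 + \<bar>exp (- 2 * x a * \<rho> a) - e\<bar> / 2 + norm (J a - good_J \<mu>) / pi)"
  have "(J \<longlongrightarrow> good_J \<mu>) F"
    unfolding J_def by (rule isCont_tendsto_compose[OF isCont_good_J \<mu>])
  then have "(B \<longlongrightarrow> \<bar>0\<bar> * 44 + \<bar>e - e\<bar> / 2 + norm (good_J \<mu> - good_J \<mu>) / pi) F"
    unfolding B_def by (intro tendsto_intros \<rho> e) auto
  then show "(B \<longlongrightarrow> 0) F" by simp
  from pos have "\<forall>\<^sub>F a in F. x a > 0 \<and> \<rho> a > 0" by (simp add: positive_family_def)
  then show "\<forall>\<^sub>F a in F. norm (\<rho> a * (good_H (x a) (\<rho> a) - M a)) \<le> B a"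
  proof eventually_elim
    case (elim a)
    define u where "u = exp (- \<i> * of_real pi * of_real (x a))"
    define N where "N = exp (- 2 * x a * \<rho> a) / (2 * \<rho> a) + 1 / (pi * \<rho> a) * Re (u * J a)"
    have "\<rho> a * (good_H (x a) (\<rho> a) - M a)
        = \<rho> a * (good_H (x a) (\<rho> a) - N) + (\<rho> a * N - \<rho> a * M a)"
      by (simp add: algebra_simps)
    also have "\<rho> a * N = exp (- 2 * x a * \<rho> a) / 2 + Re (u * J a) / pi"
      using elim by (simp add: N_def field_simps)
    also have "\<rho> a * M a = e / 2 + Re (u * good_J \<mu>) / pi"
      using elim M[of a] by (simp add: u_def)
    also have "exp (- 2 * x a * \<rho> a) / 2 + Re (u * J a) / pi - (e / 2 + Re (u * good_J \<mu>) / pi)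
        = (exp (- 2 * x a * \<rho> a) - e) / 2 + Re (u * (J a - good_J \<mu>)) / pi"
      by (simp add: diff_divide_distrib right_diff_distrib del: times_complex.sel)
    finally have eq: "\<rho> a * (good_H (x a) (\<rho> a) - M a) = \<rho> a * (good_H (x a) (\<rho> a) - N)
      + ((exp (- 2 * x a * \<rho> a) - e) / 2 + Re (u * (J a - good_J \<mu>)) / pi)" .
    have "\<bar>good_H (x a) (\<rho> a) - N\<bar> \<le> 44"
      unfolding N_def u_def J_def using elim by (intro good_H_main_bound) auto
    then have "\<bar>\<rho> a * (good_H (x a) (\<rho> a) - N)\<bar> \<le> \<bar>\<rho> a\<bar> * 44"
      unfolding abs_mult by (intro mult_left_mono) auto
    moreover have "\<bar>Re (u * (J a - good_J \<mu>))\<bar> \<le> norm (J a - good_J \<mu>)"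
      using abs_Re_le_cmod[of "u * (J a - good_J \<mu>)"]
      unfolding norm_mult u_def norm_rotation by simp
    then have "\<bar>Re (u * (J a - good_J \<mu>)) / pi\<bar> \<le> norm (J a - good_J \<mu>) / pi"
      by (simp add: abs_divide divide_right_mono)
    moreover have "\<bar>(exp (- 2 * x a * \<rho> a) - e) / 2\<bar> = \<bar>exp (- 2 * x a * \<rho> a) - e\<bar> / 2" by simp
    ultimately show ?case unfolding eq B_def real_norm_def by linarith
  qed
qed

lemma Re_rotate_good_J_0:
  "Re (exp (- \<i> * of_real pi * of_real x) * good_J 0) = pi / 2 * cos (pi * x)"
  by (simp add: good_J_0 Re_exp)

text \<open>Every admissible phase works: an even shift of \<open>\<psi>\<close> leaves the cosine
  unchanged, and if C vanishes both sides are 0.\<close>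

lemma Re_rotate_good_J_phase:
  assumes "good_phase \<mu> \<psi>"
  shows "Re (exp (- \<i> * of_real pi * of_real x) * good_J \<mu>) = good_C \<mu> * cos (pi * (x - \<psi>))"
proof -
  have "exp (- \<i> * of_real pi * of_real x) * good_J \<mu>
      = of_real (good_C \<mu>) * (exp (- \<i> * of_real pi * of_real x) * exp (\<i> * of_real pi * of_real \<psi>))"
    using assms unfolding good_phase_def by (metis mult.left_commute)
  also have "exp (- \<i> * of_real pi * of_real x) * exp (\<i> * of_real pi * of_real \<psi>)
      = cis (- (pi * (x - \<psi>)))"
    unfolding cis_conv_exp exp_add[symmetric] by (simp add: algebra_simps)
  finally show ?thesis by (simp only: Re_complex_of_real Im_complex_of_real times_complex.sel cis.sel cos_minus)
qed

lemma tendsto_exp_neg_at_top: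
  assumes "filterlim (\<lambda>a. x a * \<rho> a :: real) at_top F"
  shows "((\<lambda>a. exp (- 2 * x a * \<rho> a)) \<longlongrightarrow> 0) F"
proof -
  have "((\<lambda>y::real. exp (- 2 * y)) \<longlongrightarrow> 0) at_top" by real_asymp
  from filterlim_compose[OF this assms] show ?thesis by (simp add: mult.assoc)
qed

theorem theorem1p6:
  "(\<exists>K. \<forall>x \<rho>. x > 0 \<longrightarrow> \<rho> > 0 \<longrightarrow>
      \<bar>good_H x \<rho> - (exp (- 2 * x * \<rho>) / (2 * \<rho>)
         + 1 / (pi * \<rho>) * Re (exp (- \<i> * of_real pi * of_real x) * good_J (x * \<rho> ^ 3)))\<bar> \<le> K)
   \<and> (\<forall>(F :: 'a filter) x \<rho> \<mu> \<psi>.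
      positive_family F x \<rho> \<longrightarrow> \<mu> > 0 \<longrightarrow> good_phase \<mu> \<psi> \<longrightarrow>
      filterlim x at_top F \<longrightarrow> (\<rho> \<longlongrightarrow> 0) F \<longrightarrow> ((\<lambda>a. x a * \<rho> a ^ 3) \<longlongrightarrow> \<mu>) F \<longrightarrow>
      good_H_asymp F x \<rho> (\<lambda>a. good_C \<mu> / (pi * \<rho> a) * cos (pi * (x a - \<psi>))))
   \<and> (\<forall>(F :: 'a filter) x \<rho>.
      positive_family F x \<rho> \<longrightarrow>
      (\<rho> \<longlongrightarrow> 0) F \<longrightarrow> filterlim (\<lambda>a. x a * \<rho> a) at_top F \<longrightarrow>
      ((\<lambda>a. x a * \<rho> a ^ 3) \<longlongrightarrow> 0) F \<longrightarrow>
      good_H_asymp F x \<rho> (\<lambda>a. 1 / (2 * \<rho> a) * cos (pi * x a)))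
   \<and> (\<forall>(F :: 'a filter) x \<rho> \<mu>.
      positive_family F x \<rho> \<longrightarrow> \<mu> \<ge> 0 \<longrightarrow>
      filterlim x at_top F \<longrightarrow> ((\<lambda>a. x a * \<rho> a) \<longlongrightarrow> \<mu>) F \<longrightarrow>
      good_H_asymp F x \<rho> (\<lambda>a. (exp (- 2 * \<mu>) + cos (pi * x a)) / (2 * \<rho> a)))"
proof (intro conjI allI impI)
  show "\<exists>K. \<forall>x \<rho>. x > 0 \<longrightarrow> \<rho> > 0 \<longrightarrow>
      \<bar>good_H x \<rho> - (exp (- 2 * x * \<rho>) / (2 * \<rho>)
         + 1 / (pi * \<rho>) * Re (exp (- \<i> * of_real pi * of_real x) * good_J (x * \<rho> ^ 3)))\<bar> \<le> K"
    using good_H_main_bound by blast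
next
  fix F :: "'a filter" and x \<rho> :: "'a \<Rightarrow> real" and \<mu> \<psi> :: real
  assume pos: "positive_family F x \<rho>" and "\<mu> > 0" and phase: "good_phase \<mu> \<psi>"
    and \<rho>: "(\<rho> \<longlongrightarrow> 0) F" and lim: "((\<lambda>a. x a * \<rho> a ^ 3) \<longlongrightarrow> \<mu>) F"
  have ev: "\<forall>\<^sub>F a in F. \<rho> a > 0"
    using pos unfolding positive_family_def by eventually_elim auto
  \<comment> \<open>Since x rho = x rho^3 / rho^2 with a numerator tending to \<open>\<mu>\<close> >
    0, x rho tends to infinity and the exponential term drops out.\<close>
  have "((\<lambda>a. (\<rho> a)\<^sup>2) \<longlongrightarrow> 0) F" using tendsto_power[OF \<rho>, of 2] by simp
  then have "filterlim (\<lambda>a. (\<rho> a)\<^sup>2) (at_right 0) F"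
    unfolding filterlim_at using ev by (auto elim: eventually_mono)
  then have "filterlim (\<lambda>a. inverse ((\<rho> a)\<^sup>2)) at_top F"
    by (rule filterlim_compose[OF filterlim_inverse_at_top_right])
  then have "filterlim (\<lambda>a. x a * \<rho> a ^ 3 * inverse ((\<rho> a)\<^sup>2)) at_top F"
    by (rule filterlim_tendsto_pos_mult_at_top[OF lim \<open>\<mu> > 0\<close>])
  then have x\<rho>: "filterlim (\<lambda>a. x a * \<rho> a) at_top F"
  proof (rule filterlim_cong[THEN iffD1, OF refl refl, rotated])
    show "\<forall>\<^sub>F a in F. x a * \<rho> a ^ 3 * inverse ((\<rho> a)\<^sup>2) = x a * \<rho> a"
      using ev by eventually_elim (simp add: field_simps power2_eq_square power3_eq_cube)
  qed
  show "good_H_asymp F x \<rho> (\<lambda>a. good_C \<mu> / (pi * \<rho> a) * cos (pi * (x a - \<psi>)))"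
    by (rule good_H_asympI[OF pos \<rho> lim tendsto_exp_neg_at_top[OF x\<rho>]])
      (simp only: Re_rotate_good_J_phase[OF phase], simp)
next
  fix F :: "'a filter" and x \<rho> :: "'a \<Rightarrow> real"
  assume pos: "positive_family F x \<rho>" and \<rho>: "(\<rho> \<longlongrightarrow> 0) F"
    and x\<rho>: "filterlim (\<lambda>a. x a * \<rho> a) at_top F"
    and lim: "((\<lambda>a. x a * \<rho> a ^ 3) \<longlongrightarrow> 0) F"
  \<comment> \<open>Both limits are 0, so only J(0) / pi = 1/2 survives, as the coefficient of cos
    (pi x).\<close>
  show "good_H_asymp F x \<rho> (\<lambda>a. 1 / (2 * \<rho> a) * cos (pi * x a))"
    by (rule good_H_asympI[OF pos \<rho> lim tendsto_exp_neg_at_top[OF x\<rho>]])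
      (simp only: Re_rotate_good_J_0, simp)
next
  fix F :: "'a filter" and x \<rho> :: "'a \<Rightarrow> real" and \<mu> :: real
  assume pos: "positive_family F x \<rho>" and "\<mu> \<ge> 0" and x: "filterlim x at_top F"
    and x\<rho>: "((\<lambda>a. x a * \<rho> a) \<longlongrightarrow> \<mu>) F"
  have ev: "\<forall>\<^sub>F a in F. x a > 0"
    using pos unfolding positive_family_def by eventually_elim auto
  \<comment> \<open>In this regime rho -> 0 is derived, from rho = (x rho) / x. Then x rho^3 = (x
    rho) rho^2 also tends to 0, so J again contributes cos (pi x) / 2, now beside a surviving
    exponential.\<close>
  have "((\<lambda>a. x a * \<rho> a / x a) \<longlongrightarrow> 0) F"
    by (rule real_tendsto_divide_at_top[OF x\<rho> x])
  then have \<rho>: "(\<rho> \<longlongrightarrow> 0) F"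
    by (rule Lim_transform_eventually) (use ev in \<open>eventually_elim, simp\<close>)
  have "((\<lambda>a. x a * \<rho> a * (\<rho> a)\<^sup>2) \<longlongrightarrow> \<mu> * 0\<^sup>2) F"
    by (intro tendsto_intros x\<rho> \<rho>)
  then have lim: "((\<lambda>a. x a * \<rho> a ^ 3) \<longlongrightarrow> 0) F"
    by (simp add: power2_eq_square power3_eq_cube mult.assoc)
  have "((\<lambda>a. exp (- 2 * (x a * \<rho> a))) \<longlongrightarrow> exp (- 2 * \<mu>)) F"
    by (intro tendsto_intros x\<rho>)
  then have e: "((\<lambda>a. exp (- 2 * x a * \<rho> a)) \<longlongrightarrow> exp (- 2 * \<mu>)) F"
    by (simp add: mult.assoc)
  show "good_H_asymp F x \<rho> (\<lambda>a. (exp (- 2 * \<mu>) + cos (pi * x a)) / (2 * \<rho> a))"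
    by (rule good_H_asympI[OF pos \<rho> lim e])
      (simp only: Re_rotate_good_J_0, simp add: field_simps)
qed

end
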